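(* Let $X\sim P$ be a random vector in $\mathcal H$ with finite expectation, let $\psi$ be a score function satisfying (i)–(iv) of the context with constants $\beta,\gamma>0$, and suppose $\mathbb{E}[\rho(\|X-\mathbb{E}[X]\|)]<\min\left(\rho(\beta/3),\psi(\beta/2)^2/2\right)$. Then $$\|\mathbb{E}[X]-T(P)\|\le\frac{2}{\gamma}\left\|Z_\beta(\mathbb{E}[X])\right\|.$$
   Context: $\mathcal H$ is a real Hilbert space with norm $\|\cdot\|$ coming from its scalar product. Score function: $\psi:\mathbb{R}_+\to\mathbb{R}_+$ satisfies (i) $\psi$ is continuous and differentiable almost everywhere; (ii) $\psi(0)=0$; (iii) $\psi$ is concave; (iv) there are $\beta,\gamma>0$ with $1\ge\psi'(x)\ge\gamma\mathbf{1}\{x\le\beta\}$ for all $x\ge 0$. Put $\rho(x)=\int_0^x\psi(t)\,dt$ and let $\psi_1$ be defined by $\psi(x)=\beta\psi_1(x/\beta)$ for $x\ge0$. $T(P)$ is the (unique) solution of $\mathbb{E}\left[\frac{X-T(P)}{\|X-T(P)\|}\psi(\|X-T(P)\|)\right]=0$, equivalently the minimizer of $\theta\mapsto\mathbb{E}[\rho(\|X-\theta\|)]$. Convention: $\frac{x-\theta}{\|x-\theta\|}\psi(\|x-\theta\|)=0$ when $x=\theta$. $Z_\beta(\theta)=\mathbb{E}\left[\beta\frac{X-\theta}{\|X-\theta\|}\psi_1\left(\frac{\|X-\theta\|}{\beta}\right)\right]$. *)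

theory Defs
  imports "HOL-Probability.Probability"
begin

section \<open>Expectation of a random vector in a real Hilbert space\<close>

text \<open>The Bochner integral of the library needs a second countable codomain, that is, a separable
  Hilbert space. To cover arbitrary Hilbert spaces, the expectation of a random vector is the weak
  (Pettis) one. It exists and is unique for every Borel random vector with integrable norm
  (\<open>hexpectation_inner\<close>), and it is the Bochner integral in the separable case
  (\<open>hexpectation_eq_Bochner\<close>).\<close>

definition hexpectation :: "'w measure \<Rightarrow> ('w \<Rightarrow> 'a::real_inner) \<Rightarrow> 'a" where
  "hexpectation M X = (THE m. \<forall>h. m \<bullet> h = (\<integral>\<omega>. X \<omega> \<bullet> h \<partial>M))"

lemma hexpectation_eqI:
  assumes "\<And>h. m \<bullet> h = (\<integral>\<omega>. X \<omega> \<bullet> h \<partial>M)"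
  shows "hexpectation M X = m"
  unfolding hexpectation_def
proof (rule the_equality)
  show "\<forall>h. m \<bullet> h = (\<integral>\<omega>. X \<omega> \<bullet> h \<partial>M)" using assms by blast
next
  fix m' assume "\<forall>h. m' \<bullet> h = (\<integral>\<omega>. X \<omega> \<bullet> h \<partial>M)"
  then have "\<And>h. m' \<bullet> h = m \<bullet> h" using assms by simp
  then show "m' = m" by (metis vector_eq_rdot)
qed

lemma riesz_representation:
  fixes f :: "'a::{real_inner,complete_space} \<Rightarrow> real"
  assumes "bounded_linear f"
  shows "\<exists>m. \<forall>h. m \<bullet> h = f h"
proof -
  interpret f: bounded_linear f by fact
  obtain K where K: "\<And>x. norm (f x) \<le> norm x * K" using f.bounded by blast
  define q where "q x = (norm x)\<^sup>2 / 2 - f x" for x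
  have lower: "- (K\<^sup>2 / 2) \<le> q x" for x
  proof -
    have "f x \<le> norm x * K" using K[of x] by auto
    moreover have "0 \<le> (norm x - K)\<^sup>2" by simp
    ultimately show ?thesis by (simp add: q_def power2_diff)
  qed
  define I where "I = Inf (range q)"
  have bdd: "bdd_below (range q)" using lower by (auto intro!: bdd_belowI)
  have I_le: "I \<le> q x" for x unfolding I_def by (rule cInf_lower[OF _ bdd]) simp
  have "\<exists>x. q x < I + 1 / real (Suc n)" for n
  proof -
    have "Inf (range q) < I + 1 / real (Suc n)" by (simp add: I_def)
    then show ?thesis using bdd by (subst (asm) cInf_less_iff) auto
  qed
  then obtain x where x: "\<And>n. q (x n) < I + 1 / real (Suc n)" by metis
  have par: "(norm (a - b))\<^sup>2 \<le> 4 * (q a - I) + 4 * (q b - I)" for a b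
  proof -
    have "q ((1/2) *\<^sub>R (a + b)) = (q a + q b) / 2 - (norm (a - b))\<^sup>2 / 8"
      unfolding q_def f.scaleR f.add power2_norm_eq_inner
      by (simp add: inner_add inner_diff inner_commute field_simps)
    with I_le[of "(1/2) *\<^sub>R (a + b)"] show ?thesis by argo
  qed
  have "Cauchy x"
  proof (rule CauchyI)
    fix e :: real assume e: "0 < e"
    obtain N where N: "8 / e\<^sup>2 < real N" using reals_Archimedean2 by blast
    show "\<exists>N. \<forall>m\<ge>N. \<forall>n\<ge>N. norm (x m - x n) < e"
    proof (intro exI allI impI)
      fix m n assume mn: "N \<le> m" "N \<le> n"
      have N0: "0 < real N" using N e by (smt (verit) divide_pos_pos zero_less_power)
      have le: "1 / real (Suc k) \<le> 1 / real N" if "N \<le> k" for k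
        using that N0 by (intro divide_left_mono) auto
      have "(norm (x m - x n))\<^sup>2 \<le> 8 / real N"
        using par[of "x m" "x n"] x[of m] x[of n] le[OF mn(1)] le[OF mn(2)] by simp
      also have "\<dots> < e\<^sup>2" using N N0 e by (simp add: field_simps)
      finally show "norm (x m - x n) < e" using e by (simp add: power_less_imp_less_base)
    qed
  qed
  then obtain m where m: "x \<longlonglongrightarrow> m" using Cauchy_convergent convergent_def by blast
  have "(\<lambda>n. q (x n)) \<longlonglongrightarrow> q m"
    unfolding q_def by (intro tendsto_intros f.tendsto m) simp
  moreover have "(\<lambda>n. I + 1 / real (Suc n)) \<longlonglongrightarrow> I + 0"
    by (intro tendsto_add tendsto_const LIMSEQ_Suc lim_1_over_n)
  ultimately have "q m \<le> I + 0"
    by (rule LIMSEQ_le) (use x in \<open>auto intro: less_imp_le\<close>)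
  then have min: "q m \<le> q y" for y using I_le[of y] by simp
  have "m \<bullet> h = f h" for h
  proof -
    define c where "c = m \<bullet> h - f h"
    have q_line: "q (m + t *\<^sub>R h) = q m + t * c + t\<^sup>2 * (h \<bullet> h) / 2" for t
      unfolding q_def c_def f.scaleR f.add power2_norm_eq_inner
      by (simp add: inner_add inner_commute field_simps power2_eq_square)
    define s where "s = h \<bullet> h + 1"
    have s: "0 < s" "h \<bullet> h \<le> s" by (auto simp: s_def add_nonneg_pos)
    have "0 \<le> (- c / s) * c + (- c / s)\<^sup>2 * (h \<bullet> h) / 2"
      using min[of "m + (- c / s) *\<^sub>R h"] unfolding q_line by linarith
    also have "\<dots> \<le> (- c / s) * c + (- c / s)\<^sup>2 * s / 2"
      using s by (intro add_left_mono divide_right_mono mult_left_mono) auto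
    also have "\<dots> = - (c\<^sup>2 / (2 * s))" using s by (simp add: field_simps power2_eq_square)
    finally have "c\<^sup>2 \<le> 0" using s by (simp add: divide_le_0_iff)
    then show ?thesis by (simp add: c_def)
  qed
  then show ?thesis by blast
qed

lemma hexpectation_inner:
  fixes X :: "'w \<Rightarrow> 'a::{real_inner,complete_space}"
  assumes [measurable]: "X \<in> borel_measurable M" and int: "integrable M (\<lambda>\<omega>. norm (X \<omega>))"
  shows "integrable M (\<lambda>\<omega>. X \<omega> \<bullet> h)"
    and "hexpectation M X \<bullet> h = (\<integral>\<omega>. X \<omega> \<bullet> h \<partial>M)"
proof -
  have meas: "(\<lambda>\<omega>. X \<omega> \<bullet> h) \<in> borel_measurable M" for h
    by (rule borel_measurable_continuous_on[of "\<lambda>x. x \<bullet> h"]) (auto intro!: continuous_intros)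
  have integ: "integrable M (\<lambda>\<omega>. X \<omega> \<bullet> h)" for h
    by (rule Bochner_Integration.integrable_bound[OF integrable_mult_left[OF int, of "norm h"] meas])
      (simp add: Cauchy_Schwarz_ineq2)
  then show "integrable M (\<lambda>\<omega>. X \<omega> \<bullet> h)" .
  have "bounded_linear (\<lambda>h. \<integral>\<omega>. X \<omega> \<bullet> h \<partial>M)"
  proof (rule bounded_linear_intro)
    fix h
    have "norm (\<integral>\<omega>. X \<omega> \<bullet> h \<partial>M) \<le> (\<integral>\<omega>. norm (X \<omega> \<bullet> h) \<partial>M)"
      by (rule integral_norm_bound)
    also have "\<dots> \<le> (\<integral>\<omega>. norm (X \<omega>) * norm h \<partial>M)"
      by (rule integral_mono) (use integ int in \<open>auto simp: Cauchy_Schwarz_ineq2\<close>)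
    finally show "norm (\<integral>\<omega>. X \<omega> \<bullet> h \<partial>M) \<le> norm h * (\<integral>\<omega>. norm (X \<omega>) \<partial>M)"
      by (simp add: mult.commute)
  qed (use integ in \<open>simp_all add: inner_add_right\<close>)
  then obtain m where "\<And>h. m \<bullet> h = (\<integral>\<omega>. X \<omega> \<bullet> h \<partial>M)" using riesz_representation by blast
  then show "hexpectation M X \<bullet> h = (\<integral>\<omega>. X \<omega> \<bullet> h \<partial>M)" using hexpectation_eqI by metis
qed

lemma hexpectation_eq_Bochner:
  fixes X :: "'w \<Rightarrow> 'a::{real_inner,complete_space,second_countable_topology}"
  assumes "integrable M X"
  shows "hexpectation M X = integral\<^sup>L M X"
  using assms by (intro hexpectation_eqI) simp

section \<open>Score functions\<close>

text \<open>A function on the nonnegative half-line is represented by a function on the reals whose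
  values at negative arguments are never used; at \<open>0\<close> the derivative is the right derivative. The
  last clause bounds the derivative wherever it exists, since a score function may have corners
  (for instance the Huber score \<open>\<lambda>x. min x \<beta>\<close> at \<open>\<beta>\<close>).\<close>

definition score_function :: "(real \<Rightarrow> real) \<Rightarrow> real \<Rightarrow> real \<Rightarrow> bool" where
  "score_function \<psi> \<beta> \<gamma> \<longleftrightarrow>
     (\<forall>x\<ge>0. 0 \<le> \<psi> x) \<and>
     continuous_on {0..} \<psi> \<and>
     (AE x in lborel. 0 \<le> x \<longrightarrow> \<psi> differentiable (at x within {0..})) \<and>
     \<psi> 0 = 0 \<and>
     concave_on {0..} \<psi> \<and>
     0 < \<beta> \<and> 0 < \<gamma> \<and>
     (\<forall>x\<ge>0. \<forall>d. (\<psi> has_real_derivative d) (at x within {0..}) \<longrightarrow>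
        d \<le> 1 \<and> \<gamma> * indicator {..\<beta>} x \<le> d)"

definition rho :: "(real \<Rightarrow> real) \<Rightarrow> real \<Rightarrow> real" where
  "rho \<psi> x = integral {0..x} \<psi>"

text \<open>The solution of \<open>\<psi> x = \<beta> * \<psi>\<^sub>1 (x / \<beta>)\<close> for \<open>x \<ge> 0\<close>.\<close>

definition psi1 :: "(real \<Rightarrow> real) \<Rightarrow> real \<Rightarrow> real \<Rightarrow> real" where
  "psi1 \<psi> \<beta> y = \<psi> (\<beta> * y) / \<beta>"

lemma psi1_eq: "0 < \<beta> \<Longrightarrow> \<psi> x = \<beta> * psi1 \<psi> \<beta> (x / \<beta>)"
  by (simp add: psi1_def)

section \<open>The M-estimator functional and the influence term\<close>

text \<open>The unit vector \<open>(x - \<theta>) / \<parallel>x - \<theta>\<parallel>\<close> is \<open>sgn (x - \<theta>)\<close>, which is \<open>0\<close> when \<open>x = \<theta>\<close>.\<close>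

definition T_functional :: "(real \<Rightarrow> real) \<Rightarrow> 'a::real_inner measure \<Rightarrow> 'a" where
  "T_functional \<psi> P =
     (THE \<theta>. hexpectation P (\<lambda>x. \<psi> (norm (x - \<theta>)) *\<^sub>R sgn (x - \<theta>)) = 0)"

definition Z_fun ::
  "'w measure \<Rightarrow> ('w \<Rightarrow> 'a::real_inner) \<Rightarrow> (real \<Rightarrow> real) \<Rightarrow> real \<Rightarrow> 'a \<Rightarrow> 'a" where
  "Z_fun M X \<psi> \<beta> \<theta> =
     hexpectation M (\<lambda>\<omega>. (\<beta> * psi1 \<psi> \<beta> (norm (X \<omega> - \<theta>) / \<beta>)) *\<^sub>R sgn (X \<omega> - \<theta>))"

end

theory Submission
  imports Defs
begin

text \<open>The map \<open>F v = \<psi> \<parallel>v\<parallel> v / \<parallel>v\<parallel>\<close> is the gradient of the convex function \<open>\<rho> \<parallel>v\<parallel>\<close>, which is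
  \<open>\<gamma>\<close>-strongly convex on the ball of radius \<open>\<beta>\<close> and has a 1-Lipschitz gradient. Let
  \<open>J \<theta> = E \<rho> \<parallel>X - \<theta>\<parallel>\<close>, whose gradient is \<open>-Z\<close>. Points of the sublevel set \<open>J < \<rho> (\<beta>/3)\<close>, which
  contains \<open>E X\<close>, are at distance less than \<open>2\<beta>/3\<close>, and \<open>X\<close> is within \<open>\<beta>/3\<close> of each of them with
  positive probability. Hence \<open>J\<close> is strongly convex there, so it has a unique minimizer, the only
  zero \<open>T\<close> of \<open>Z\<close>. For the bound, split the segment from \<open>E X\<close> to \<open>T\<close> at its midpoint: each half has
  length at most \<open>\<beta>/3\<close>, and by Markov's inequality and \<open>\<rho> (2\<beta>/3) \<ge> 2 \<rho> (\<beta>/3)\<close> both of its ends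
  are within \<open>\<beta>\<close> of \<open>X\<close> with probability at least 1/2, so \<open>-Z\<close> is \<open>\<gamma>/2\<close>-strongly monotone along
  the segment.\<close>

section \<open>Monotone, concave and radial functions\<close>

lemma mono_on_closed_interval:
  fixes h :: "real \<Rightarrow> real"
  assumes cont: "continuous_on {a..b} h"
    and mono: "\<And>x y. a < x \<Longrightarrow> x < y \<Longrightarrow> y < b \<Longrightarrow> h x \<le> h y"
  shows "mono_on {a..b} h"
proof (rule mono_onI)
  fix x y assume x: "x \<in> {a..b}" and y: "y \<in> {a..b}" and "x \<le> y"
  show "h x \<le> h y"
  proof (cases "x = y")
    case False
    with \<open>x \<le> y\<close> have xy: "x < y" by simp
    \<comment> \<open>Moving both ends inwards by \<open>t\<close> puts them into the open interval,
      in the right order as long as \<open>t < (y - x) / 2\<close>. Continuity then takes the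
      inequality to \<open>t = 0\<close>.\<close>
    have ev: "\<forall>\<^sub>F t in at_right 0. 0 < t \<and> t < (y - x) / 2"
      using xy unfolding eventually_at_right_field by (intro exI[of _ "(y - x) / 2"]) auto
    have "((\<lambda>t. h (x + t)) \<longlongrightarrow> h x) (at_right 0)"
      by (rule continuous_on_tendsto_compose[OF cont _ x])
        (use ev x y xy in \<open>auto intro!: tendsto_eq_intros elim!: eventually_mono\<close>)
    moreover have "((\<lambda>t. h (y - t)) \<longlongrightarrow> h y) (at_right 0)"
      by (rule continuous_on_tendsto_compose[OF cont _ y])
        (use ev x y xy in \<open>auto intro!: tendsto_eq_intros elim!: eventually_mono\<close>)
    moreover have "\<forall>\<^sub>F t in at_right 0. h (x + t) \<le> h (y - t)"
      using ev by eventually_elim (rule mono, use x y in auto)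
    ultimately show ?thesis by (intro tendsto_le[of "at_right (0::real)"]) auto
  qed simp
qed

text \<open>Concavity is cleared of denominators here, so that it can later be added to tangent
  inequalities by linear arithmetic.\<close>

lemma concave_on_three_points:
  fixes f :: "real \<Rightarrow> real"
  assumes f: "concave_on S f" and S: "x \<in> S" "z \<in> S" and le: "x \<le> y" "y \<le> z"
  shows "(z - y) * f x + (y - x) * f z \<le> (z - x) * f y"
proof (cases "x = z")
  case False
  with le have xz: "x < z" by simp
  define u v where "u = (z - y) / (z - x)" and "v = (y - x) / (z - x)"
  have uv: "0 \<le> u" "0 \<le> v" "u + v = 1" "(z - x) * u = z - y" "(z - x) * v = y - x"
    using xz le by (auto simp: u_def v_def add_divide_distrib[symmetric])
  have "(z - x) * (u * x + v * z) = (z - y) * x + (y - x) * z"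
    unfolding uv(4,5)[symmetric] by (simp add: algebra_simps)
  also have "\<dots> = (z - x) * y" by (simp add: algebra_simps)
  finally have y: "u *\<^sub>R x + v *\<^sub>R z = y" using xz by simp
  have "u * f x + v * f z \<le> f y"
    using f S uv(1-3) unfolding concave_on_iff y[symmetric] by blast
  then have "(z - x) * (u * f x + v * f z) \<le> (z - x) * f y"
    using xz by (intro mult_left_mono) auto
  then show ?thesis by (simp add: distrib_left mult.assoc[symmetric] uv(4,5))
qed (use le in simp)

lemma concave_below_tangent:
  fixes f :: "real \<Rightarrow> real"
  assumes "concave_on {a..} f" "a < z" "(f has_real_derivative d) (at z within {a..})" "a \<le> x"
  shows "f x \<le> f z + d * (x - z)"
proof -
  have "- f x - - f z \<ge> (- d) * (x - z)"
    by (rule convex_on_imp_above_tangent[of "{a..}" "\<lambda>x. - f x"])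
      (use assms in \<open>auto simp: concave_on_def intro!: derivative_intros\<close>)
  then show ?thesis by simp
qed

text \<open>The mean value theorem gives an \<open>r\<close> between \<open>a\<close> and
  \<open>b\<close> with \<open>G b - G a = \<phi> r * (b - a)\<close>, and monotonicity compares
  \<open>\<phi> r\<close> with \<open>\<phi> a\<close>. Derivatives are taken within
  \<open>S\<close>, which admits the end points of \<open>S\<close>.\<close>

lemma monotone_primitive_above_tangent:
  fixes G \<phi> :: "real \<Rightarrow> real"
  assumes S: "is_interval S" "a \<in> S" "b \<in> S"
    and deriv: "\<And>r. r \<in> S \<Longrightarrow> (G has_real_derivative \<phi> r) (at r within S)"
    and mono: "mono_on S \<phi>"
  shows "G a + \<phi> a * (b - a) \<le> G b"
proof -
  have between: "r \<in> S" if "p \<in> S" "q \<in> S" "p \<le> r" "r \<le> q" for p q r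
    using S(1) that unfolding is_interval_1 by blast
  have mvt: "\<exists>r\<in>{p..q}. G q - G p = \<phi> r * (q - p)" if "p \<in> S" "q \<in> S" "p \<le> q" for p q
  proof -
    have sub: "{p..q} \<subseteq> S" using between[OF that(1,2)] by auto
    show ?thesis
    proof (rule mvt_very_simple[OF that(3)])
      fix r assume "p \<le> r" "r \<le> q"
      then have "r \<in> S" using sub by auto
      from DERIV_subset[OF deriv[OF this] sub]
      show "(G has_derivative (*) (\<phi> r)) (at r within {p..q})"
        by (simp add: has_field_derivative_def)
    qed
  qed
  consider "a \<le> b" | "b \<le> a" by linarith
  then show ?thesis
  proof cases
    case 1
    then obtain r where r: "r \<in> {a..b}" "G b - G a = \<phi> r * (b - a)" using mvt S by blast
    then have "r \<in> S" using between[OF S(2,3)] by auto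
    then have "\<phi> a * (b - a) \<le> \<phi> r * (b - a)"
      using r S mono by (intro mult_right_mono) (auto dest: mono_onD)
    with r show ?thesis by simp
  next
    case 2
    then obtain r where r: "r \<in> {b..a}" "G a - G b = \<phi> r * (a - b)" using mvt S by blast
    then have "r \<in> S" using between[OF S(3,2)] by auto
    then have "\<phi> r * (a - b) \<le> \<phi> a * (a - b)"
      using r S mono by (intro mult_right_mono) (auto dest: mono_onD)
    with r show ?thesis by (simp add: algebra_simps)
  qed
qed

text \<open>The convexity of the norm, \<open>sgn x \<bullet> (y - x) \<le> norm y - norm x\<close>,
  is fed into the scalar tangent inequality; \<open>0 \<le> \<phi> (norm x)\<close> keeps its
  direction. \<open>G\<close> is generic because \<open>rho\<close>, \<open>rho\<close> minus a
  quadratic and a quadratic minus \<open>rho\<close> will all take its place.\<close>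

lemma radial_above_tangent:
  fixes x y :: "'a::real_inner" and G \<phi> :: "real \<Rightarrow> real"
  assumes S: "is_interval S" "norm x \<in> S" "norm y \<in> S"
    and deriv: "\<And>r. r \<in> S \<Longrightarrow> (G has_real_derivative \<phi> r) (at r within S)"
    and mono: "mono_on S \<phi>" and nonneg: "0 \<le> \<phi> (norm x)"
  shows "G (norm x) + (\<phi> (norm x) *\<^sub>R sgn x) \<bullet> (y - x) \<le> G (norm y)"
proof -
  have "sgn x \<bullet> x = norm x" by (cases "x = 0") (simp_all add: sgn_div_norm dot_square_norm power2_eq_square)
  moreover have "sgn x \<bullet> y \<le> norm y"
    using norm_cauchy_schwarz[of "sgn x" y] mult_right_mono[of "norm (sgn x)" 1 "norm y"]
    by (simp add: norm_sgn split: if_splits)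
  ultimately have "sgn x \<bullet> (y - x) \<le> norm y - norm x" by (simp add: inner_diff_right)
  then have "\<phi> (norm x) * (sgn x \<bullet> (y - x)) \<le> \<phi> (norm x) * (norm y - norm x)"
    using nonneg by (rule mult_left_mono)
  moreover have "G (norm x) + \<phi> (norm x) * (norm y - norm x) \<le> G (norm y)"
    by (rule monotone_primitive_above_tangent[OF S deriv mono])
  ultimately show ?thesis by simp
qed

lemma ex_point_of_AE_lborel:
  fixes a b :: real
  assumes "AE x in lborel. Q x" "a < b"
  shows "\<exists>x. a < x \<and> x < b \<and> Q x"
proof (rule ccontr)
  assume "\<nexists>x. a < x \<and> x < b \<and> Q x"
  then have "AE x in lborel. x \<notin> {a<..<b}" using assms(1) by (auto elim!: eventually_mono)
  then have "emeasure lborel {a<..<b} = 0"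
    by (subst (asm) AE_iff_measurable[of "{a<..<b}"]) auto
  then show False using assms(2) by simp
qed

lemma inner_eq_norm_mult_sgn:
  fixes x h :: "'a::real_inner"
  shows "x \<bullet> h = norm x * (sgn x \<bullet> h)"
  by (cases "x = 0") (simp_all add: sgn_div_norm)

section \<open>Slopes of a score function and convexity of its primitive\<close>

locale score =
  fixes \<psi> :: "real \<Rightarrow> real" and \<beta> \<gamma> :: real
  assumes score: "score_function \<psi> \<beta> \<gamma>"
begin

lemma score_simps:
  shows nonneg: "0 \<le> x \<Longrightarrow> 0 \<le> \<psi> x"
    and cont: "continuous_on {0..} \<psi>"
    and zero: "\<psi> 0 = 0"
    and concave: "concave_on {0..} \<psi>"
    and beta_pos: "0 < \<beta>"
    and gamma_pos: "0 < \<gamma>"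
    and deriv_le: "0 \<le> x \<Longrightarrow> (\<psi> has_real_derivative d) (at x within {0..}) \<Longrightarrow> d \<le> 1"
    and deriv_ge: "0 \<le> x \<Longrightarrow> (\<psi> has_real_derivative d) (at x within {0..}) \<Longrightarrow>
      \<gamma> * indicator {..\<beta>} x \<le> d"
  using score unfolding score_function_def by auto

text \<open>One point of differentiability in each interval is enough: concavity carries a slope
  bound at that point over to the increments on one side of it.\<close>

lemma ex_derivative:
  assumes "0 \<le> a" "a < b"
  shows "\<exists>z d. a < z \<and> z < b \<and> (\<psi> has_real_derivative d) (at z within {0..})"
proof -
  have "AE x in lborel. 0 \<le> x \<longrightarrow> \<psi> differentiable (at x within {0..})"
    using score unfolding score_function_def by blast
  from ex_point_of_AE_lborel[OF this \<open>a < b\<close>] obtain z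
    where "a < z" "z < b" "0 \<le> z \<longrightarrow> \<psi> differentiable (at z within {0..})" by auto
  then show ?thesis
    using assms unfolding real_differentiable_def by (meson less_imp_le order.strict_trans1)
qed

text \<open>Slopes of a concave function decrease to the right. The tangent at \<open>z\<close>,
  evaluated at \<open>x\<close> and scaled by \<open>y - x\<close>, is added to the chord inequality
  for \<open>x\<close>, \<open>y\<close>, \<open>z\<close>; a common factor \<open>z - x\<close>
  then cancels.\<close>

lemma increment_ge:
  assumes "0 \<le> x" "x < y" "y \<le> z" "(\<psi> has_real_derivative d) (at z within {0..})"
  shows "d * (y - x) \<le> \<psi> y - \<psi> x"
proof -
  have "\<psi> x \<le> \<psi> z + d * (x - z)"
    using assms by (intro concave_below_tangent[OF concave]) auto
  then have "(y - x) * \<psi> x \<le> (y - x) * (\<psi> z + d * (x - z))"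
    using assms by (intro mult_left_mono) auto
  moreover have "(z - y) * \<psi> x + (y - x) * \<psi> z \<le> (z - x) * \<psi> y"
    using assms by (intro concave_on_three_points[OF concave]) auto
  ultimately have "(z - x) * (d * (y - x)) \<le> (z - x) * (\<psi> y - \<psi> x)"
    by (simp add: algebra_simps)
  then show ?thesis using assms by simp
qed

lemma increment_le:
  assumes "0 < z" "z \<le> x" "x < y" "(\<psi> has_real_derivative d) (at z within {0..})"
  shows "\<psi> y - \<psi> x \<le> d * (y - x)"
proof -
  have "\<psi> y \<le> \<psi> z + d * (y - z)"
    using assms by (intro concave_below_tangent[OF concave]) auto
  then have "(y - x) * \<psi> y \<le> (y - x) * (\<psi> z + d * (y - z))"
    using assms by (intro mult_left_mono) auto
  moreover have "(y - x) * \<psi> z + (x - z) * \<psi> y \<le> (y - z) * \<psi> x"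
    using assms by (intro concave_on_three_points[OF concave]) auto
  ultimately have "(y - z) * (\<psi> y - \<psi> x) \<le> (y - z) * (d * (y - x))"
    by (simp add: algebra_simps)
  then show ?thesis using assms by simp
qed

lemma mono_psi: "mono_on {0..} \<psi>"
proof (rule mono_onI)
  fix x y :: real assume xy: "x \<in> {0..}" "y \<in> {0..}" "x \<le> y"
  obtain z d where z: "y < z" "(\<psi> has_real_derivative d) (at z within {0..})"
    using ex_derivative[of y "y + 1"] xy by auto
  have "0 \<le> d" using deriv_ge[OF _ z(2)] gamma_pos xy z
    by (smt (verit) atLeast_iff indicator_pos_le mult_nonneg_nonneg)
  then have "0 \<le> d * (y - x)" using xy by simp
  then show "\<psi> x \<le> \<psi> y"
    using increment_ge[of x y z d] xy z by (cases "x = y") auto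
qed

lemma mono_psi_minus: "mono_on {0..\<beta>} (\<lambda>r. \<psi> r - \<gamma> * r)"
proof (rule mono_on_closed_interval)
  show "continuous_on {0..\<beta>} (\<lambda>r. \<psi> r - \<gamma> * r)"
    by (intro continuous_intros continuous_on_subset[OF cont]) auto
  fix x y assume xy: "0 < x" "x < y" "y < \<beta>"
  \<comment> \<open>The point must lie to the right of \<open>y\<close> and still below
    \<open>\<beta>\<close>, where the indicator equals 1. This is why the end point
    \<open>\<beta>\<close> is reached only by continuity.\<close>
  then obtain z d where z: "y < z" "z < \<beta>" "(\<psi> has_real_derivative d) (at z within {0..})"
    using ex_derivative[of y \<beta>] by auto
  have "\<gamma> * (y - x) \<le> d * (y - x)"
    using deriv_ge[OF _ z(3)] z xy by (intro mult_right_mono) auto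
  then show "\<psi> x - \<gamma> * x \<le> \<psi> y - \<gamma> * y"
    using increment_ge[of x y z d] xy z by (auto simp: algebra_simps)
qed

lemma mono_minus_psi: "mono_on {0..} (\<lambda>r. r - \<psi> r)"
proof (rule mono_onI)
  fix p q :: real assume pq: "p \<in> {0..}" "q \<in> {0..}" "p \<le> q"
  have "mono_on {0..q} (\<lambda>r. r - \<psi> r)"
  proof (rule mono_on_closed_interval)
    show "continuous_on {0..q} (\<lambda>r. r - \<psi> r)"
      by (intro continuous_intros continuous_on_subset[OF cont]) auto
    fix x y assume xy: "0 < x" "x < y" "y < q"
    \<comment> \<open>An upper slope bound needs a point to the left of \<open>x\<close>, hence
      \<open>0 < x\<close>; the end point 0 is reached by continuity.\<close>
    then obtain z d where z: "0 < z" "z < x" "(\<psi> has_real_derivative d) (at z within {0..})"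
      using ex_derivative[of 0 x] by auto
    have "d * (y - x) \<le> 1 * (y - x)"
      using deriv_le[OF _ z(3)] z xy by (intro mult_right_mono) auto
    from order_trans[OF increment_le[OF z(1) less_imp_le[OF z(2)] xy(2) z(3)] this]
    show "x - \<psi> x \<le> y - \<psi> y" by simp
  qed
  then show "p - \<psi> p \<le> q - \<psi> q" by (rule mono_onD) (use pq in auto)
qed

lemma psi_le: "0 \<le> r \<Longrightarrow> \<psi> r \<le> r"
  using mono_onD[OF mono_minus_psi, of 0 r] zero by simp

lemma psi_ge: "0 \<le> r \<Longrightarrow> r \<le> \<beta> \<Longrightarrow> \<gamma> * r \<le> \<psi> r"
  using mono_onD[OF mono_psi_minus, of 0 r] zero by simp

lemma rho_zero: "rho \<psi> 0 = 0"
  by (simp add: rho_def)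

lemma rho_deriv:
  assumes "0 \<le> r"
  shows "(rho \<psi> has_real_derivative \<psi> r) (at r within {0..})"
proof -
  have "(rho \<psi> has_real_derivative \<psi> r) (at r within {0..r+1})"
    unfolding rho_def
    by (rule integral_has_real_derivative)
      (use assms in \<open>auto intro: continuous_on_subset[OF cont]\<close>)
  moreover have "at r within {0..r+1} = at r within {0..}"
    by (rule at_within_nhd[of _ "{..<r+1}"]) (use assms in auto)
  ultimately show ?thesis by simp
qed

lemma rho_above_tangent: "0 \<le> a \<Longrightarrow> 0 \<le> b \<Longrightarrow> rho \<psi> a + \<psi> a * (b - a) \<le> rho \<psi> b"
  by (rule monotone_primitive_above_tangent[OF _ _ _ rho_deriv mono_psi])
    (auto simp: is_interval_ci)

lemma rho_nonneg: "0 \<le> r \<Longrightarrow> 0 \<le> rho \<psi> r"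
  using rho_above_tangent[of 0 r] by (simp add: rho_zero zero)

lemma rho_mono: "0 \<le> a \<Longrightarrow> a \<le> b \<Longrightarrow> rho \<psi> a \<le> rho \<psi> b"
  using rho_above_tangent[of a b] nonneg[of a] by (smt (verit) mult_nonneg_nonneg)

text \<open>The tangent at \<open>a\<close>, evaluated at 0 and at \<open>2 * a\<close>, gives
  \<open>rho \<psi> a \<le> a * \<psi> a \<le> rho \<psi> (2 * a) - rho \<psi> a\<close>.\<close>

lemma rho_double: "0 \<le> a \<Longrightarrow> 2 * rho \<psi> a \<le> rho \<psi> (2 * a)"
  using rho_above_tangent[of a 0] rho_above_tangent[of a "2 * a"] by (simp add: rho_zero)

text \<open>The tangent at \<open>d / 2\<close> is evaluated at \<open>a\<close> and at
  \<open>b\<close>; the linear terms add up to \<open>\<psi> (d / 2) * (a + b - d)\<close>, which is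
  nonnegative.\<close>

lemma rho_midpoint:
  assumes "0 \<le> a" "0 \<le> b" "0 \<le> d" "d \<le> a + b"
  shows "2 * rho \<psi> (d / 2) \<le> rho \<psi> a + rho \<psi> b"
proof -
  have "0 \<le> \<psi> (d / 2) * (a + b - d)" using assms nonneg by simp
  then have "0 \<le> \<psi> (d / 2) * (a - d / 2) + \<psi> (d / 2) * (b - d / 2)"
    by (simp add: algebra_simps)
  then show ?thesis
    using rho_above_tangent[of "d / 2" a] rho_above_tangent[of "d / 2" b] assms by linarith
qed

lemma continuous_rho: "continuous_on {0..} (rho \<psi>)"
  by (rule DERIV_continuous_on) (use rho_deriv in auto)

section \<open>The vector field \<open>F\<close> and quadratic bounds for the radial loss\<close>

definition F :: "'a::real_inner \<Rightarrow> 'a" where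
  "F v = \<psi> (norm v) *\<^sub>R sgn v"

lemma norm_F_le: "norm (F v) \<le> norm v"
  by (simp add: F_def norm_sgn psi_le nonneg)

lemma continuous_F: "continuous_on UNIV (F :: 'a::real_inner \<Rightarrow> 'a)"
proof (rule continuous_at_imp_continuous_on, rule ballI)
  fix v :: 'a
  have psi_norm: "isCont (\<lambda>v::'a. \<psi> (norm v)) v"
  proof -
    have "continuous_on UNIV (\<lambda>v::'a. \<psi> (norm v))"
      by (rule continuous_on_compose2[OF cont continuous_on_norm_id]) auto
    then show ?thesis by (auto simp: continuous_on_eq_continuous_at)
  qed
  show "isCont F v"
  proof (cases "v = 0")
    \<comment> \<open>At the origin \<open>sgn\<close> jumps, but
      \<open>norm (F v) \<le> norm v\<close> squeezes \<open>F\<close> to 0.\<close>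
    case True
    have "(F \<longlongrightarrow> 0) (at 0)"
      by (rule Lim_null_comparison[of _ norm]) (auto simp: norm_F_le intro!: tendsto_eq_intros)
    then show ?thesis using True by (simp add: isCont_def F_def)
  next
    case False
    then show ?thesis unfolding F_def by (intro continuous_intros psi_norm) auto
  qed
qed

lemma rho_norm_above_tangent:
  fixes x y :: "'a::real_inner"
  shows "rho \<psi> (norm x) + F x \<bullet> (y - x) \<le> rho \<psi> (norm y)"
  unfolding F_def
  by (rule radial_above_tangent[OF _ _ _ rho_deriv mono_psi]) (auto simp: is_interval_ci nonneg)

lemma half_norm_square_expansion:
  fixes x y :: "'a::real_inner"
  shows "(norm y)\<^sup>2 / 2 = (norm x)\<^sup>2 / 2 + x \<bullet> (y - x) + (norm (y - x))\<^sup>2 / 2"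
  by (simp add: power2_norm_eq_inner inner_diff inner_commute field_simps)

text \<open>On \<open>{0..\<beta>}\<close> the function
  \<open>rho \<psi> r - \<gamma> / 2 * r\<^sup>2\<close> has the nonnegative nondecreasing
  derivative \<open>\<psi> r - \<gamma> * r\<close>, so the radial inequality applies to it. The
  exact expansion of the square restores the quadratic term.\<close>

lemma rho_norm_strongly_above_tangent:
  fixes x y :: "'a::real_inner"
  assumes "norm x \<le> \<beta>" "norm y \<le> \<beta>"
  shows "rho \<psi> (norm x) + F x \<bullet> (y - x) + \<gamma> / 2 * (norm (y - x))\<^sup>2 \<le> rho \<psi> (norm y)"
proof -
  have "(rho \<psi> (norm x) - \<gamma> / 2 * (norm x)\<^sup>2)
      + ((\<psi> (norm x) - \<gamma> * norm x) *\<^sub>R sgn x) \<bullet> (y - x)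
      \<le> rho \<psi> (norm y) - \<gamma> / 2 * (norm y)\<^sup>2"
    by (rule radial_above_tangent[where S = "{0..\<beta>}" and G = "\<lambda>r. rho \<psi> r - \<gamma> / 2 * r\<^sup>2"
          and \<phi> = "\<lambda>r. \<psi> r - \<gamma> * r"])
      (use assms psi_ge in \<open>auto simp: is_interval_cc mono_psi_minus
        intro!: derivative_eq_intros DERIV_subset[OF rho_deriv]\<close>)
  moreover have "((\<psi> (norm x) - \<gamma> * norm x) *\<^sub>R sgn x) \<bullet> (y - x)
      = F x \<bullet> (y - x) - \<gamma> * (x \<bullet> (y - x))"
    by (simp add: F_def inner_eq_norm_mult_sgn[of x] left_diff_distrib)
  moreover have "\<gamma> / 2 * (norm y)\<^sup>2
      = \<gamma> / 2 * (norm x)\<^sup>2 + \<gamma> * (x \<bullet> (y - x)) + \<gamma> / 2 * (norm (y - x))\<^sup>2"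
    using arg_cong[OF half_norm_square_expansion[of y x], of "(*) \<gamma>"] by (simp add: algebra_simps)
  ultimately show ?thesis by linarith
qed

text \<open>Here the radial inequality is applied to \<open>r\<^sup>2 / 2 - rho \<psi> r\<close>,
  with derivative \<open>r - \<psi> r\<close>. The bound serves to compare losses at different
  centres and to show that a minimizer of \<open>J\<close> is a zero of \<open>Z\<close>.\<close>

lemma rho_norm_below_parabola:
  fixes x y :: "'a::real_inner"
  shows "rho \<psi> (norm y) \<le> rho \<psi> (norm x) + F x \<bullet> (y - x) + (norm (y - x))\<^sup>2 / 2"
proof -
  have "((norm x)\<^sup>2 / 2 - rho \<psi> (norm x)) + ((norm x - \<psi> (norm x)) *\<^sub>R sgn x) \<bullet> (y - x)
      \<le> (norm y)\<^sup>2 / 2 - rho \<psi> (norm y)"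
    by (rule radial_above_tangent[where S = "{0..}" and G = "\<lambda>r. r\<^sup>2 / 2 - rho \<psi> r"
          and \<phi> = "\<lambda>r. r - \<psi> r"])
      (use psi_le in \<open>auto simp: is_interval_ci mono_minus_psi
        intro!: derivative_eq_intros rho_deriv\<close>)
  moreover have "((norm x - \<psi> (norm x)) *\<^sub>R sgn x) \<bullet> (y - x) = x \<bullet> (y - x) - F x \<bullet> (y - x)"
    by (simp add: F_def inner_eq_norm_mult_sgn[of x] left_diff_distrib)
  ultimately show ?thesis using half_norm_square_expansion[of y x] by linarith
qed

end

section \<open>The expected loss \<open>J\<close> and its negative gradient \<open>Z\<close>\<close>

locale score_sample = score \<psi> \<beta> \<gamma> + prob_space M
  for \<psi> :: "real \<Rightarrow> real" and \<beta> \<gamma> :: real and M :: "'w measure" +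
  fixes X :: "'w \<Rightarrow> 'a::{real_inner,complete_space}" and m :: 'a
  assumes X_measurable [measurable]: "X \<in> borel_measurable M"
    and integrable_norm_X: "integrable M (\<lambda>\<omega>. norm (X \<omega>))"
    and integrable_rho_m: "integrable M (\<lambda>\<omega>. rho \<psi> (norm (X \<omega> - m)))"
    and small: "(\<integral>\<omega>. rho \<psi> (norm (X \<omega> - m)) \<partial>M) < rho \<psi> (\<beta> / 3)"
begin

definition J :: "'a \<Rightarrow> real" where
  "J \<theta> = (\<integral>\<omega>. rho \<psi> (norm (X \<omega> - \<theta>)) \<partial>M)"

definition Z :: "'a \<Rightarrow> 'a" where
  "Z \<theta> = hexpectation M (\<lambda>\<omega>. F (X \<omega> - \<theta>))"

lemma norm_diff_measurable [measurable]: "(\<lambda>\<omega>. norm (X \<omega> - \<theta>)) \<in> borel_measurable M"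
  by (rule borel_measurable_continuous_on[of "\<lambda>x. norm (x - \<theta>)"])
    (auto intro!: continuous_intros)

lemma F_diff_measurable: "(\<lambda>\<omega>. F (X \<omega> - \<theta>)) \<in> borel_measurable M"
  by (rule borel_measurable_continuous_on[of "\<lambda>x. F (x - \<theta>)"])
    (auto intro!: continuous_intros continuous_on_compose2[OF continuous_F])

lemma rho_norm_diff_measurable: "(\<lambda>\<omega>. rho \<psi> (norm (X \<omega> - \<theta>))) \<in> borel_measurable M"
  by (rule borel_measurable_continuous_on[of "\<lambda>x. rho \<psi> (norm (x - \<theta>))"])
    (auto intro!: continuous_intros continuous_on_compose2[OF continuous_rho])

lemma integrable_norm_F: "integrable M (\<lambda>\<omega>. norm (F (X \<omega> - \<theta>)))"
proof (rule Bochner_Integration.integrable_bound)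
  show "integrable M (\<lambda>\<omega>. norm (X \<omega>) + norm \<theta>)" using integrable_norm_X by simp
  show "(\<lambda>\<omega>. norm (F (X \<omega> - \<theta>))) \<in> borel_measurable M"
    by (rule borel_measurable_continuous_on[OF _ F_diff_measurable]) (intro continuous_intros)
  show "AE \<omega> in M. norm (norm (F (X \<omega> - \<theta>))) \<le> norm (norm (X \<omega>) + norm \<theta>)"
  proof (rule AE_I2)
    fix \<omega>
    have "norm (F (X \<omega> - \<theta>)) \<le> norm (X \<omega>) + norm \<theta>"
      by (rule order_trans[OF norm_F_le norm_triangle_ineq4])
    then show "norm (norm (F (X \<omega> - \<theta>))) \<le> norm (norm (X \<omega>) + norm \<theta>)" by simp
  qed
qed

lemma
  shows integrable_F_inner: "integrable M (\<lambda>\<omega>. F (X \<omega> - \<theta>) \<bullet> h)"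
    and Z_inner: "Z \<theta> \<bullet> h = (\<integral>\<omega>. F (X \<omega> - \<theta>) \<bullet> h \<partial>M)"
  unfolding Z_def by (rule hexpectation_inner[OF F_diff_measurable integrable_norm_F])+

text \<open>Integrability at the centre \<open>m\<close> spreads to every centre: moving the centre
  raises the loss by at most a term linear in \<open>F (X \<omega> - m)\<close> plus a
  constant.\<close>

lemma integrable_rho: "integrable M (\<lambda>\<omega>. rho \<psi> (norm (X \<omega> - \<theta>)))"
proof (rule Bochner_Integration.integrable_bound)
  let ?b = "\<lambda>\<omega>. rho \<psi> (norm (X \<omega> - m)) + F (X \<omega> - m) \<bullet> (m - \<theta>) + (norm (m - \<theta>))\<^sup>2 / 2"
  show "integrable M ?b" using integrable_rho_m integrable_F_inner by simp
  show "AE \<omega> in M. norm (rho \<psi> (norm (X \<omega> - \<theta>))) \<le> norm (?b \<omega>)"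
  proof (rule AE_I2)
    fix \<omega>
    have "rho \<psi> (norm (X \<omega> - \<theta>)) \<le> ?b \<omega>"
      using rho_norm_below_parabola[of "X \<omega> - \<theta>" "X \<omega> - m"] by simp
    then show "norm (rho \<psi> (norm (X \<omega> - \<theta>))) \<le> norm (?b \<omega>)"
      using rho_nonneg[of "norm (X \<omega> - \<theta>)"] by simp
  qed
qed (rule rho_norm_diff_measurable)

lemma J_nonneg: "0 \<le> J \<theta>"
  unfolding J_def by (rule integral_nonneg_AE) (simp add: rho_nonneg)

lemma J_m_less: "J m < rho \<psi> (\<beta> / 3)"
  using small by (simp add: J_def)

lemma rho_third_pos: "0 < rho \<psi> (\<beta> / 3)"
  using J_nonneg[of m] J_m_less by simp

text \<open>The strong tangent inequality is integrated over \<open>A\<close> and the plain one over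
  its complement. The increment from \<open>X \<omega> - \<theta>\<close> to
  \<open>X \<omega> - \<theta>'\<close> is \<open>\<theta> - \<theta>'\<close>, which explains the
  sign in the linear term. The empty \<open>A\<close> gives plain convexity.\<close>

lemma J_strongly_above_tangent:
  assumes A: "A \<in> sets M"
    and le: "\<And>\<omega>. \<omega> \<in> A \<Longrightarrow> norm (X \<omega> - \<theta>) \<le> \<beta>" "\<And>\<omega>. \<omega> \<in> A \<Longrightarrow> norm (X \<omega> - \<theta>') \<le> \<beta>"
  shows "J \<theta> + Z \<theta> \<bullet> (\<theta> - \<theta>') + \<gamma> / 2 * (norm (\<theta> - \<theta>'))\<^sup>2 * prob A \<le> J \<theta>'"
proof -
  let ?q = "\<gamma> / 2 * (norm (\<theta> - \<theta>'))\<^sup>2"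
  have int_A: "integrable M (\<lambda>\<omega>. ?q * indicator A \<omega>)"
    using A by (intro integrable_mult_right integrable_real_indicator) (simp_all add: less_top[symmetric])
  have "J \<theta> + Z \<theta> \<bullet> (\<theta> - \<theta>') + ?q * prob A
      = (\<integral>\<omega>. rho \<psi> (norm (X \<omega> - \<theta>)) + F (X \<omega> - \<theta>) \<bullet> (\<theta> - \<theta>') + ?q * indicator A \<omega> \<partial>M)"
    using A int_A integrable_rho integrable_F_inner by (simp add: J_def Z_inner)
  also have "\<dots> \<le> (\<integral>\<omega>. rho \<psi> (norm (X \<omega> - \<theta>')) \<partial>M)"
  proof (rule integral_mono)
    fix \<omega>
    show "rho \<psi> (norm (X \<omega> - \<theta>)) + F (X \<omega> - \<theta>) \<bullet> (\<theta> - \<theta>') + ?q * indicator A \<omega>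
        \<le> rho \<psi> (norm (X \<omega> - \<theta>'))"
      using rho_norm_strongly_above_tangent[of "X \<omega> - \<theta>" "X \<omega> - \<theta>'"]
        rho_norm_above_tangent[of "X \<omega> - \<theta>" "X \<omega> - \<theta>'"] le[of \<omega>]
      by (cases "\<omega> \<in> A") simp_all
  qed (use int_A integrable_rho integrable_F_inner in auto)
  finally show ?thesis by (simp add: J_def)
qed

lemma J_above_tangent: "J \<theta> + Z \<theta> \<bullet> (\<theta> - \<theta>') \<le> J \<theta>'"
  using J_strongly_above_tangent[of "{}" \<theta> \<theta>'] by simp

lemma J_below_parabola: "J \<theta>' \<le> J \<theta> + Z \<theta> \<bullet> (\<theta> - \<theta>') + (norm (\<theta> - \<theta>'))\<^sup>2 / 2"
proof -
  have "J \<theta>' \<le> (\<integral>\<omega>. rho \<psi> (norm (X \<omega> - \<theta>)) + F (X \<omega> - \<theta>) \<bullet> (\<theta> - \<theta>')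
      + (norm (\<theta> - \<theta>'))\<^sup>2 / 2 \<partial>M)"
    unfolding J_def
  proof (rule integral_mono)
    fix \<omega>
    show "rho \<psi> (norm (X \<omega> - \<theta>'))
        \<le> rho \<psi> (norm (X \<omega> - \<theta>)) + F (X \<omega> - \<theta>) \<bullet> (\<theta> - \<theta>') + (norm (\<theta> - \<theta>'))\<^sup>2 / 2"
      using rho_norm_below_parabola[of "X \<omega> - \<theta>'" "X \<omega> - \<theta>"] by simp
  qed (use integrable_rho integrable_F_inner in auto)
  also have "\<dots> = J \<theta> + Z \<theta> \<bullet> (\<theta> - \<theta>') + (norm (\<theta> - \<theta>'))\<^sup>2 / 2"
    using integrable_rho integrable_F_inner by (simp add: J_def Z_inner prob_space)
  finally show ?thesis .
qed

text \<open>The tangent at the midpoint is evaluated at both ends, where its linear terms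
  cancel.\<close>

lemma J_midpoint_le:
  assumes "J \<theta> \<le> L" "J \<theta>' \<le> L"
  shows "J ((1 / 2) *\<^sub>R (\<theta> + \<theta>')) \<le> L"
proof -
  define c where "c = (1 / 2) *\<^sub>R (\<theta> + \<theta>')"
  have "(c - \<theta>) + (c - \<theta>') = 0"
    by (simp add: c_def algebra_simps flip: scaleR_2 scaleR_add_left)
  then have "Z c \<bullet> (c - \<theta>) + Z c \<bullet> (c - \<theta>') = 0" by (metis inner_add_right inner_zero_right)
  then show ?thesis
    using J_above_tangent[of c \<theta>] J_above_tangent[of c \<theta>'] assms unfolding c_def by linarith
qed

section \<open>Uniform convexity of \<open>J\<close> on the sublevel set\<close>

lemma prob_near_ge:
  assumes r: "0 \<le> r" "0 < rho \<psi> r"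
  shows "1 - J \<theta> / rho \<psi> r \<le> prob {\<omega> \<in> space M. norm (X \<omega> - \<theta>) \<le> r}"
proof -
  have "1 - prob {\<omega> \<in> space M. norm (X \<omega> - \<theta>) \<le> r}
      = prob {\<omega> \<in> space M. \<not> norm (X \<omega> - \<theta>) \<le> r}"
    by (rule prob_neg[symmetric]) measurable
  \<comment> \<open>Monotonicity of \<open>rho\<close> turns the event of a large distance into one
    of a large loss, to which Markov's inequality applies.\<close>
  also have "\<dots> \<le> prob {\<omega> \<in> space M. rho \<psi> r \<le> rho \<psi> (norm (X \<omega> - \<theta>))}"
    using rho_norm_diff_measurable[of \<theta>] r(1)
    by (intro finite_measure_mono) (auto intro!: rho_mono borel_measurable_le)
  also have "\<dots> \<le> J \<theta> / rho \<psi> r"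
    unfolding J_def
    by (rule integral_Markov_inequality_measure[where A = "space M"])
      (use r integrable_rho in \<open>auto simp: rho_nonneg\<close>)
  finally show ?thesis by simp
qed

text \<open>If the centres were at least \<open>2 * \<beta> / 3\<close> apart, the distances from
  \<open>X\<close> to them would add up to at least that much, and \<open>rho_midpoint\<close> would
  force \<open>J \<theta> + J \<theta>' \<ge> 2 * rho \<psi> (\<beta> / 3)\<close>.\<close>

lemma sublevel_dist_less:
  assumes "J \<theta> < rho \<psi> (\<beta> / 3)" "J \<theta>' < rho \<psi> (\<beta> / 3)"
  shows "norm (\<theta> - \<theta>') < 2 * \<beta> / 3"
proof (rule ccontr)
  assume "\<not> ?thesis"
  then have ge: "\<beta> / 3 \<le> norm (\<theta> - \<theta>') / 2" by simp
  have "2 * rho \<psi> (\<beta> / 3) = (\<integral>\<omega>. 2 * rho \<psi> (\<beta> / 3) \<partial>M)" by (simp add: prob_space)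
  also have "\<dots> \<le> (\<integral>\<omega>. rho \<psi> (norm (X \<omega> - \<theta>)) + rho \<psi> (norm (X \<omega> - \<theta>')) \<partial>M)"
  proof (rule integral_mono)
    fix \<omega>
    have "norm (\<theta> - \<theta>') \<le> norm (X \<omega> - \<theta>) + norm (X \<omega> - \<theta>')"
      using norm_triangle_ineq4[of "X \<omega> - \<theta>'" "X \<omega> - \<theta>"] by simp
    then have "2 * rho \<psi> (norm (\<theta> - \<theta>') / 2)
        \<le> rho \<psi> (norm (X \<omega> - \<theta>)) + rho \<psi> (norm (X \<omega> - \<theta>'))"
      by (intro rho_midpoint) auto
    then show "2 * rho \<psi> (\<beta> / 3) \<le> rho \<psi> (norm (X \<omega> - \<theta>)) + rho \<psi> (norm (X \<omega> - \<theta>'))"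
      using rho_mono[OF _ ge] beta_pos by linarith
  qed (use integrable_rho in auto)
  also have "\<dots> = J \<theta> + J \<theta>'" using integrable_rho by (simp add: J_def)
  finally show False using assms by simp
qed

lemma J_uniformly_convex:
  assumes L: "J \<theta> \<le> L" "J \<theta>' \<le> L" "L < rho \<psi> (\<beta> / 3)"
  shows "J ((1 / 2) *\<^sub>R (\<theta> + \<theta>')) + \<gamma> / 8 * (1 - L / rho \<psi> (\<beta> / 3)) * (norm (\<theta> - \<theta>'))\<^sup>2
    \<le> (J \<theta> + J \<theta>') / 2"
proof -
  define c where "c = (1 / 2) *\<^sub>R (\<theta> + \<theta>')"
  \<comment> \<open>On this event \<open>X\<close> is within \<open>\<beta> / 3\<close> of
    \<open>\<theta>\<close>; since the centres are less than \<open>2 * \<beta> / 3\<close> apart,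
    it is within \<open>\<beta>\<close> of \<open>\<theta>'\<close> and of the midpoint as
    well.\<close>
  define A where "A = {\<omega> \<in> space M. norm (X \<omega> - \<theta>) \<le> \<beta> / 3}"
  have A: "A \<in> sets M" unfolding A_def by measurable
  have c1: "c - \<theta> = (1 / 2) *\<^sub>R (\<theta>' - \<theta>)"
    by (simp add: c_def algebra_simps flip: scaleR_2 scaleR_add_left)
  have c2: "c - \<theta>' = - (c - \<theta>)"
    by (simp add: c_def algebra_simps flip: scaleR_2 scaleR_add_left)
  have n1: "norm (c - \<theta>) = norm (\<theta> - \<theta>') / 2" by (simp add: c1 norm_minus_commute)
  have n2: "norm (c - \<theta>') = norm (\<theta> - \<theta>') / 2" unfolding c2 norm_minus_cancel by (rule n1)
  have d: "norm (\<theta> - \<theta>') < 2 * \<beta> / 3" using L by (intro sublevel_dist_less) auto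
  have near: "norm (X \<omega> - \<theta>) \<le> \<beta>" "norm (X \<omega> - \<theta>') \<le> \<beta>" "norm (X \<omega> - c) \<le> \<beta>"
    if "\<omega> \<in> A" for \<omega>
    using that beta_pos d n1 norm_triangle_ineq[of "X \<omega> - \<theta>" "\<theta> - \<theta>'"]
      norm_triangle_ineq[of "X \<omega> - \<theta>" "\<theta> - c"] norm_minus_commute[of \<theta> c]
    by (auto simp: A_def)
  define p where "p = 1 - L / rho \<psi> (\<beta> / 3)"
  \<comment> \<open>The constant 1/8 is 1/2 times the square of one half: the midpoint is at half
    the distance from either end.\<close>
  define s where "s = \<gamma> / 8 * (norm (\<theta> - \<theta>'))\<^sup>2"
  have s: "\<gamma> / 2 * (norm (c - \<theta>))\<^sup>2 = s" "\<gamma> / 2 * (norm (c - \<theta>'))\<^sup>2 = s"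
    unfolding n1 n2 s_def by (simp_all add: power_divide)
  have "p \<le> 1 - J \<theta> / rho \<psi> (\<beta> / 3)"
    unfolding p_def using L(1) rho_third_pos by (simp add: divide_right_mono)
  also have "\<dots> \<le> prob A"
    unfolding A_def using beta_pos rho_third_pos by (intro prob_near_ge) auto
  finally have "s * p \<le> s * prob A"
    unfolding s_def using gamma_pos by (intro mult_left_mono) auto
  moreover have "J c + Z c \<bullet> (c - \<theta>) + s * prob A \<le> J \<theta>"
    unfolding s(1)[symmetric] by (rule J_strongly_above_tangent[OF A near(3,1)])
  moreover have "J c + Z c \<bullet> (c - \<theta>') + s * prob A \<le> J \<theta>'"
    unfolding s(2)[symmetric] by (rule J_strongly_above_tangent[OF A near(3,2)])
  moreover have "Z c \<bullet> (c - \<theta>') = - (Z c \<bullet> (c - \<theta>))" by (simp only: c2 inner_minus_right)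
  ultimately have "J c + s * p \<le> (J \<theta> + J \<theta>') / 2" by argo
  then show ?thesis by (simp only: c_def p_def s_def ac_simps)
qed

section \<open>Existence and uniqueness of the zero of \<open>Z\<close>\<close>

lemma ex_minimizer: "\<exists>\<theta>. \<forall>\<theta>'. J \<theta> \<le> J \<theta>'"
proof -
  define I where "I = Inf (range J)"
  \<comment> \<open>A level strictly between \<open>J m\<close> and
    \<open>rho \<psi> (\<beta> / 3)\<close>: the convexity modulus \<open>k\<close> stays positive,
    and the slack \<open>\<delta>\<close> keeps the whole minimizing sequence below
    \<open>L\<close>.\<close>
  define L where "L = (J m + rho \<psi> (\<beta> / 3)) / 2"
  define \<delta> where "\<delta> = L - J m"
  define k where "k = \<gamma> * (1 - L / rho \<psi> (\<beta> / 3))"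
  have L: "L < rho \<psi> (\<beta> / 3)" and \<delta>: "0 < \<delta>" using J_m_less by (auto simp: L_def \<delta>_def)
  have k: "0 < k" using L rho_third_pos gamma_pos by (simp add: k_def)
  have bdd: "bdd_below (range J)" using J_nonneg by (auto intro!: bdd_belowI)
  have I_le: "I \<le> J \<theta>" for \<theta> unfolding I_def by (rule cInf_lower[OF _ bdd]) simp
  have "\<exists>\<theta>. J \<theta> < I + \<delta> / real (Suc n)" for n
  proof -
    have "Inf (range J) < I + \<delta> / real (Suc n)" using \<delta> by (simp add: I_def)
    then show ?thesis using bdd by (subst (asm) cInf_less_iff) auto
  qed
  then obtain x where x: "\<And>n. J (x n) < I + \<delta> / real (Suc n)" by metis
  have x_le: "J (x n) \<le> L" for n
  proof -
    have "\<delta> / real (Suc n) \<le> \<delta>" using \<delta> by (simp add: divide_le_eq)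
    then show ?thesis using x[of n] I_le[of m] by (simp add: \<delta>_def)
  qed
  \<comment> \<open>At the midpoint of \<open>x i\<close> and \<open>x j\<close> the value of
    \<open>J\<close> is at least \<open>I\<close>, so uniform convexity bounds the distance of the
    two points by their excess over \<open>I\<close>. Hence the minimizing sequence is
    Cauchy.\<close>
  have gap: "k * (norm (x i - x j))\<^sup>2 \<le> 4 * (J (x i) - I) + 4 * (J (x j) - I)" for i j
  proof -
    have "J ((1 / 2) *\<^sub>R (x i + x j)) + k * (norm (x i - x j))\<^sup>2 / 8 \<le> (J (x i) + J (x j)) / 2"
      using J_uniformly_convex[OF x_le x_le L, of i j] by (simp only: k_def times_divide_eq_left)
    then show ?thesis using I_le[of "(1 / 2) *\<^sub>R (x i + x j)"] by argo
  qed
  have "Cauchy x"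
  proof (rule CauchyI)
    fix e :: real assume e: "0 < e"
    obtain N where N: "8 * \<delta> / (k * e\<^sup>2) < real N" using reals_Archimedean2 by blast
    have N0: "0 < real N"
      using N e k \<delta> by (smt (verit) divide_pos_pos mult_pos_pos zero_less_power)
    have le: "\<delta> / real (Suc i) \<le> \<delta> / real N" if "N \<le> i" for i
      using that N0 \<delta> by (intro divide_left_mono) auto
    show "\<exists>N. \<forall>i\<ge>N. \<forall>j\<ge>N. norm (x i - x j) < e"
    proof (intro exI allI impI)
      fix i j assume ij: "N \<le> i" "N \<le> j"
      have "k * (norm (x i - x j))\<^sup>2 \<le> 8 * \<delta> / real N"
        using gap[of i j] x[of i] x[of j] le[OF ij(1)] le[OF ij(2)] by simp
      also have "\<dots> < k * e\<^sup>2" using N N0 e k by (simp add: field_simps)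
      finally have "(norm (x i - x j))\<^sup>2 < e\<^sup>2" using k by simp
      then show "norm (x i - x j) < e" using e by (simp add: power_less_imp_less_base)
    qed
  qed
  then obtain y where y: "x \<longlonglongrightarrow> y" using Cauchy_convergent convergent_def by blast
  \<comment> \<open>The tangent at the limit \<open>y\<close>, evaluated at \<open>x n\<close>,
    stands in for lower semicontinuity of \<open>J\<close>: it lies below \<open>J (x n)\<close> and
    tends to \<open>J y\<close>.\<close>
  have "(\<lambda>n. J y + Z y \<bullet> (y - x n)) \<longlonglongrightarrow> J y + Z y \<bullet> (y - y)"
    by (intro tendsto_intros y)
  moreover have "(\<lambda>n. I + \<delta> * (1 / real (Suc n))) \<longlonglongrightarrow> I + \<delta> * 0"
    by (intro tendsto_add tendsto_mult tendsto_const LIMSEQ_Suc lim_1_over_n)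
  moreover have "\<exists>N. \<forall>n\<ge>N. J y + Z y \<bullet> (y - x n) \<le> I + \<delta> * (1 / real (Suc n))"
  proof (intro exI allI impI)
    fix n
    show "J y + Z y \<bullet> (y - x n) \<le> I + \<delta> * (1 / real (Suc n))"
      using J_above_tangent[of y "x n"] x[of n] by simp
  qed
  ultimately have "J y + Z y \<bullet> (y - y) \<le> I + \<delta> * 0" by (rule LIMSEQ_le)
  then show ?thesis using I_le by (intro exI[of _ y]) (auto intro: order_trans)
qed

text \<open>A gradient step of length one from the minimizer, to
  \<open>\<theta> + Z \<theta>\<close>, would lower \<open>J\<close> by at least half the square of
  \<open>norm (Z \<theta>)\<close>.\<close>

lemma ex_root: "\<exists>\<theta>. Z \<theta> = 0"
proof -
  obtain \<theta> where min: "\<And>\<theta>'. J \<theta> \<le> J \<theta>'" using ex_minimizer by blast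
  have "J \<theta> \<le> J \<theta> - Z \<theta> \<bullet> Z \<theta> + (norm (Z \<theta>))\<^sup>2 / 2"
    using min[of "\<theta> + Z \<theta>"] J_below_parabola[of "\<theta> + Z \<theta>" \<theta>] by simp
  then have "(norm (Z \<theta>))\<^sup>2 \<le> 0" by (simp add: power2_norm_eq_inner)
  then show ?thesis by auto
qed

lemma root_le: "Z \<theta> = 0 \<Longrightarrow> J \<theta> \<le> J \<theta>'"
  using J_above_tangent[of \<theta> \<theta>'] by simp

text \<open>Both zeros minimize \<open>J\<close>, so they lie below the level \<open>J m\<close>,
  and the value at their midpoint is no lower than theirs. Uniform convexity then leaves no distance
  between them.\<close>

lemma root_unique:
  assumes "Z \<theta> = 0" "Z \<theta>' = 0"
  shows "\<theta> = \<theta>'"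
proof -
  define k where "k = \<gamma> / 8 * (1 - J m / rho \<psi> (\<beta> / 3))"
  have "J ((1 / 2) *\<^sub>R (\<theta> + \<theta>')) + k * (norm (\<theta> - \<theta>'))\<^sup>2 \<le> (J \<theta> + J \<theta>') / 2"
    unfolding k_def by (rule J_uniformly_convex[OF root_le root_le J_m_less]) (rule assms)+
  moreover have "J \<theta> \<le> J ((1 / 2) *\<^sub>R (\<theta> + \<theta>'))" "J \<theta>' \<le> J ((1 / 2) *\<^sub>R (\<theta> + \<theta>'))"
    using assms by (auto intro: root_le)
  ultimately have "k * (norm (\<theta> - \<theta>'))\<^sup>2 \<le> 0" by argo
  moreover have "0 < k" using J_m_less rho_third_pos gamma_pos by (simp add: k_def)
  ultimately have "(norm (\<theta> - \<theta>'))\<^sup>2 \<le> 0" by (simp add: mult_le_0_iff)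
  then show ?thesis by simp
qed

section \<open>Strong monotonicity and the distance bound\<close>

lemma Z_strongly_monotone:
  assumes \<theta>: "J \<theta> \<le> J m" and d: "norm (\<theta> - \<theta>') \<le> \<beta> / 3"
  shows "\<gamma> / 2 * (norm (\<theta> - \<theta>'))\<^sup>2 \<le> (Z \<theta> - Z \<theta>') \<bullet> (\<theta>' - \<theta>)"
proof -
  \<comment> \<open>The radius \<open>2 * (\<beta> / 3)\<close> leaves \<open>\<beta> / 3\<close>
    for the step to \<open>\<theta>'\<close>, and \<open>rho_double\<close> makes this event have
    probability at least 1/2.\<close>
  define A where "A = {\<omega> \<in> space M. norm (X \<omega> - \<theta>) \<le> 2 * (\<beta> / 3)}"
  have A: "A \<in> sets M" unfolding A_def by measurable
  have near: "norm (X \<omega> - \<theta>) \<le> \<beta>" "norm (X \<omega> - \<theta>') \<le> \<beta>" if "\<omega> \<in> A" for \<omega>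
    using that beta_pos d norm_triangle_ineq[of "X \<omega> - \<theta>" "\<theta> - \<theta>'"] by (auto simp: A_def)
  have rho: "2 * rho \<psi> (\<beta> / 3) \<le> rho \<psi> (2 * (\<beta> / 3))"
    using beta_pos by (intro rho_double) simp
  then have pos: "0 < rho \<psi> (2 * (\<beta> / 3))" using rho_third_pos by linarith
  have "2 * J \<theta> \<le> rho \<psi> (2 * (\<beta> / 3))" using \<theta> J_m_less rho by linarith
  then have "1 / 2 \<le> 1 - J \<theta> / rho \<psi> (2 * (\<beta> / 3))" using pos by (simp add: field_simps)
  also have "\<dots> \<le> prob A"
    unfolding A_def using beta_pos pos by (intro prob_near_ge) auto
  finally have "\<gamma> * (norm (\<theta> - \<theta>'))\<^sup>2 * (1 / 2) \<le> \<gamma> * (norm (\<theta> - \<theta>'))\<^sup>2 * prob A"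
    using gamma_pos by (intro mult_left_mono) auto
  moreover have "J \<theta> + Z \<theta> \<bullet> (\<theta> - \<theta>') + \<gamma> / 2 * (norm (\<theta> - \<theta>'))\<^sup>2 * prob A \<le> J \<theta>'"
    by (rule J_strongly_above_tangent[OF A near])
  moreover have "J \<theta>' + Z \<theta>' \<bullet> (\<theta>' - \<theta>) + \<gamma> / 2 * (norm (\<theta>' - \<theta>))\<^sup>2 * prob A \<le> J \<theta>"
    by (rule J_strongly_above_tangent[OF A near(2,1)])
  \<comment> \<open>Adding the tangent inequalities in both directions cancels \<open>J\<close>; two
    terms with factor \<open>\<gamma> / 2\<close> and probability at least 1/2 leave
    \<open>\<gamma> / 2\<close>.\<close>
  ultimately show ?thesis
    by (simp add: norm_minus_commute[of \<theta>' \<theta>] inner_diff_left inner_diff_right)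
qed

lemma root_dist_le:
  assumes T: "Z T = 0"
  shows "\<gamma> / 2 * norm (m - T) \<le> norm (Z m)"
proof -
  define c where "c = (1 / 2) *\<^sub>R (m + T)"
  define v where "v = (1 / 2) *\<^sub>R (T - m)"
  have steps: "c - m = v" "T - c = v"
    by (simp_all add: c_def v_def algebra_simps flip: scaleR_2 scaleR_add_left)
  have v: "norm (m - c) = norm v" "norm (c - T) = norm v"
    using steps by (metis norm_minus_commute)+
  have d: "norm (m - T) = 2 * norm v" by (simp add: v_def norm_minus_commute)
  have J_T: "J T \<le> J m" by (rule root_le[OF T])
  \<comment> \<open>The second half step starts at \<open>c\<close>, so \<open>c\<close> must lie in
    the sublevel set of \<open>m\<close> too.\<close>
  have J_c: "J c \<le> J m" unfolding c_def using J_T by (intro J_midpoint_le) auto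
  have "norm (m - T) < 2 * \<beta> / 3" using J_T J_m_less by (intro sublevel_dist_less) auto
  then have v_le: "norm v \<le> \<beta> / 3" using d by simp
  have "\<gamma> / 2 * (norm v)\<^sup>2 \<le> (Z m - Z c) \<bullet> v"
    using Z_strongly_monotone[of m c] v_le by (simp add: v steps)
  moreover have "\<gamma> / 2 * (norm v)\<^sup>2 \<le> (Z c - Z T) \<bullet> v"
    using Z_strongly_monotone[OF J_c, of T] v_le by (simp add: v steps)
  \<comment> \<open>The two half steps telescope to \<open>Z m - Z T\<close>, and
    \<open>Z T = 0\<close>.\<close>
  ultimately have "\<gamma> * (norm v)\<^sup>2 \<le> Z m \<bullet> v" by (simp add: T inner_diff_left)
  also have "\<dots> \<le> norm (Z m) * norm v" by (rule norm_cauchy_schwarz)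
  finally have "\<gamma> * norm v * norm v \<le> norm (Z m) * norm v" by (simp add: power2_eq_square)
  then have "\<gamma> * norm v \<le> norm (Z m)" by (cases "v = 0") simp_all
  then show ?thesis by (simp add: d)
qed

section \<open>Transfer to the functionals of the statement\<close>

lemma Z_T_functional: "Z (T_functional \<psi> (distr M borel X)) = 0"
proof -
  have "hexpectation (distr M borel X) (\<lambda>x. \<psi> (norm (x - \<theta>)) *\<^sub>R sgn (x - \<theta>)) = Z \<theta>" for \<theta>
  \<comment> \<open>The change of variables from the law of \<open>X\<close> to \<open>M\<close> is
    made for the real functions obtained by pairing with \<open>h\<close>, as the weak expectation
    is defined through them.\<close>
  proof (rule hexpectation_eqI)
    fix h
    have "continuous_on UNIV (\<lambda>x. F (x - \<theta>) \<bullet> h)"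
      by (intro continuous_intros continuous_on_compose2[OF continuous_F]) auto
    then have "(\<lambda>x. F (x - \<theta>) \<bullet> h) \<in> borel_measurable borel"
      by (rule borel_measurable_continuous_onI)
    then show "Z \<theta> \<bullet> h
        = (\<integral>x. (\<psi> (norm (x - \<theta>)) *\<^sub>R sgn (x - \<theta>)) \<bullet> h \<partial>distr M borel X)"
      by (simp add: integral_distr[OF X_measurable] Z_inner F_def)
  qed
  then have "T_functional \<psi> (distr M borel X) = (THE \<theta>. Z \<theta> = 0)"
    by (simp add: T_functional_def)
  \<comment> \<open>Existence and uniqueness give the definite description in
    \<open>T_functional\<close> its meaning.\<close>
  moreover have "\<exists>!\<theta>. Z \<theta> = 0" using ex_root root_unique by blast
  ultimately show ?thesis using theI'[of "\<lambda>\<theta>. Z \<theta> = 0"] by simp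
qed

lemma Z_fun_eq: "Z_fun M X \<psi> \<beta> \<theta> = Z \<theta>"
  using beta_pos by (simp add: Z_fun_def Z_def F_def psi1_def)

end

theorem theorem2:
  fixes M :: "'w measure" and P :: "'a::{real_inner,complete_space} measure"
    and X :: "'w \<Rightarrow> 'a" and \<psi> :: "real \<Rightarrow> real" and \<beta> \<gamma> :: real
  assumes "prob_space M"
    and "X \<in> borel_measurable M"
    and "P = distr M borel X"
    and "integrable M (\<lambda>\<omega>. norm (X \<omega>))"
    and "score_function \<psi> \<beta> \<gamma>"
    and "integrable M (\<lambda>\<omega>. rho \<psi> (norm (X \<omega> - hexpectation M X)))"
    and "(\<integral>\<omega>. rho \<psi> (norm (X \<omega> - hexpectation M X)) \<partial>M)
           < min (rho \<psi> (\<beta> / 3)) ((\<psi> (\<beta> / 2))\<^sup>2 / 2)"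
  shows "norm (hexpectation M X - T_functional \<psi> P)
           \<le> 2 / \<gamma> * norm (Z_fun M X \<psi> \<beta> (hexpectation M X))"
proof -
  interpret prob_space M by fact
  interpret score_sample \<psi> \<beta> \<gamma> M X "hexpectation M X"
    by unfold_locales (use assms in auto)
  have "\<gamma> / 2 * norm (hexpectation M X - T_functional \<psi> P) \<le> norm (Z (hexpectation M X))"
    unfolding assms(3) by (rule root_dist_le[OF Z_T_functional])
  then show ?thesis using gamma_pos by (simp add: Z_fun_eq field_simps)
qed

end
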